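(* For every singular cardinal $\mu$, $\mathfrak{a}_\mu\geqslant\min\{\mathfrak{b}_\mu,\mathfrak{b}_{\operatorname{cf}\mu}\}$.
   Context: For an infinite cardinal $\mu$, a family of sets $\mathcal{A}$ is $\mu$-almost disjoint if $|A|=\mu=|\bigcup\mathcal{A}|$ for every $A\in\mathcal{A}$ and $|A\cap B|<\mu$ for all distinct $A,B\in\mathcal{A}$; it is $\mu$-mad if moreover there is no $C\subseteq\bigcup\mathcal{A}$ with $\mathcal{A}\cup\{C\}$ $\mu$-almost disjoint. Such a family with fewer than $\operatorname{cf}\mu$ members is trivial. $\operatorname{MAD}(\mu)$ is the set of cardinalities of nontrivial $\mu$-mad families and $\mathfrak{a}_\mu=\min\operatorname{MAD}(\mu)$. For a quasi-order $(P,\le)$ without maximum, $\mathfrak{b}(P,\le)$ is the least size of a subset of $P$ with no upper bound. For regular $\kappa$, $\mathfrak{b}_\kappa=\mathfrak{b}(\kappa^\kappa,\leqslant^* )$ where $f\leqslant^* g$ iff $|\{i<\kappa: f(i)>g(i)\}|<\kappa$. For singular $\mu$ of cofinality $\kappa$, $\mathfrak{b}_\mu$ is the supremum of $\mathfrak{b}(\prod_{i<\kappa}\mu_i,\leqslant^* )$ over all strictly increasing sequences $\langle\mu_i:i<\kappa\rangle$ of regular cardinals with supremum $\mu$ (with $\leqslant^*$ meaning inequality except on a bounded subset of $\kappa$). *)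

theory Defs
  imports Main "HOL-Library.FuncSet"
begin

unbundle cardinal_syntax

text \<open>
  A cardinal is represented, as in the HOL cardinal library, by a \<^const>\<open>card_order_on\<close>
  relation, and cardinals are identified up to \<open>=o\<close>. A set of cardinals is a set of
  such relations, and its minimum and supremum are determined only up to \<open>=o\<close>.
\<close>

definition card_Min :: "'a rel set \<Rightarrow> 'a rel" where
  "card_Min R = (SOME r. r \<in> R \<and> (\<forall>r'\<in>R. r \<le>o r'))"

text \<open>
  All members of \<open>R\<close> are at most the cardinality of the type, so an upper bound (hence a
  least one) exists among the cardinals represented on that type.
\<close>

definition card_Sup :: "'a rel set \<Rightarrow> 'a rel" where
  "card_Sup R = card_Min {r. Card_order r \<and> (\<forall>s\<in>R. s \<le>o r)}"

definition cf :: "'a rel \<Rightarrow> 'a rel" where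
  "cf \<mu> = card_Min {|K| | K. K \<subseteq> Field \<mu> \<and> cofinal K \<mu>}"

definition regular_cardinal :: "'a rel \<Rightarrow> bool" where
  "regular_cardinal \<mu> \<longleftrightarrow> Cinfinite \<mu> \<and> regularCard \<mu>"

definition singular_cardinal :: "'a rel \<Rightarrow> bool" where
  "singular_cardinal \<mu> \<longleftrightarrow> Cinfinite \<mu> \<and> \<not> regularCard \<mu>"

text \<open>
  The members of a family are sets over the type that carries \<open>\<mu>\<close>. This is no
  restriction: if a \<open>\<mu>\<close>-almost disjoint family is nonempty, its union has size \<open>\<mu>\<close>, so
  \<open>\<mu>\<close> is represented by a relation on the type of the union.
\<close>

definition almost_disjoint :: "'a rel \<Rightarrow> 'a set set \<Rightarrow> bool" where
  "almost_disjoint \<mu> \<A> \<longleftrightarrow>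
     (\<forall>A\<in>\<A>. |A| =o \<mu> \<and> |\<Union>\<A>| =o \<mu>) \<and>
     (\<forall>A\<in>\<A>. \<forall>B\<in>\<A>. A \<noteq> B \<longrightarrow> |A \<inter> B| <o \<mu>)"

text \<open>In the maximality clause \<open>C\<close> must be new: \<open>C \<in> \<A>\<close> would give \<open>insert C \<A> = \<A>\<close>.\<close>

definition mad :: "'a rel \<Rightarrow> 'a set set \<Rightarrow> bool" where
  "mad \<mu> \<A> \<longleftrightarrow> almost_disjoint \<mu> \<A> \<and>
     \<not> (\<exists>C. C \<subseteq> \<Union>\<A> \<and> C \<notin> \<A> \<and> almost_disjoint \<mu> (insert C \<A>))"

definition trivial_family :: "'a rel \<Rightarrow> 'a set set \<Rightarrow> bool" where
  "trivial_family \<mu> \<A> \<longleftrightarrow> |\<A>| <o cf \<mu>"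

definition MAD :: "'a rel \<Rightarrow> 'a set rel set" where
  "MAD \<mu> = {|\<A>| | \<A>. mad \<mu> \<A> \<and> \<not> trivial_family \<mu> \<A>}"

definition a_num :: "'a rel \<Rightarrow> 'a set rel" where
  "a_num \<mu> = card_Min (MAD \<mu>)"

text \<open>Meaningful when \<open>le\<close> is a quasi-order on \<open>P\<close> without maximum.\<close>

definition unbounding_number :: "'p set \<Rightarrow> ('p \<Rightarrow> 'p \<Rightarrow> bool) \<Rightarrow> 'p rel" where
  "unbounding_number P le =
     card_Min {|B| | B. B \<subseteq> P \<and> \<not> (\<exists>g\<in>P. \<forall>f\<in>B. le f g)}"

definition le_star :: "'a rel \<Rightarrow> ('a \<Rightarrow> 'a) \<Rightarrow> ('a \<Rightarrow> 'a) \<Rightarrow> bool" where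
  "le_star \<kappa> f g \<longleftrightarrow> |{i \<in> Field \<kappa>. (g i, f i) \<in> \<kappa> \<and> f i \<noteq> g i}| <o \<kappa>"

definition b_regular :: "'a rel \<Rightarrow> ('a \<Rightarrow> 'a) rel" where
  "b_regular \<kappa> = unbounding_number (Field \<kappa> \<rightarrow>\<^sub>E Field \<kappa>) (le_star \<kappa>)"

text \<open>
  A sequence of cardinals indexed by the cardinal \<open>\<kappa>\<close> is a function on \<^term>\<open>Field \<kappa>\<close>;
  only its values there matter. A cardinal \<open>m i\<close>, viewed as the set of its ordinals, is
  \<^term>\<open>Field (m i)\<close> ordered by \<^term>\<open>m i\<close>.
\<close>

definition le_star_prod ::
    "'a rel \<Rightarrow> ('a \<Rightarrow> 'a rel) \<Rightarrow> ('a \<Rightarrow> 'a) \<Rightarrow> ('a \<Rightarrow> 'a) \<Rightarrow> bool" where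
  "le_star_prod \<kappa> m f g \<longleftrightarrow>
     (\<exists>j\<in>Field \<kappa>. \<forall>i\<in>Field \<kappa>. (f i, g i) \<notin> m i \<longrightarrow> (i, j) \<in> \<kappa>)"

definition regular_sequence :: "'a rel \<Rightarrow> 'a rel \<Rightarrow> ('a \<Rightarrow> 'a rel) \<Rightarrow> bool" where
  "regular_sequence \<mu> \<kappa> m \<longleftrightarrow>
     (\<forall>i\<in>Field \<kappa>. regular_cardinal (m i)) \<and>
     (\<forall>i j. (i, j) \<in> \<kappa> \<and> i \<noteq> j \<longrightarrow> m i <o m j) \<and>
     card_Sup (m ` Field \<kappa>) =o \<mu>"

definition b_singular :: "'a rel \<Rightarrow> ('a \<Rightarrow> 'a) rel" where
  "b_singular \<mu> = card_Sup
     {unbounding_number (\<Pi>\<^sub>E i\<in>Field (cf \<mu>). Field (m i)) (le_star_prod (cf \<mu>) m)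
      | m. regular_sequence \<mu> (cf \<mu>) m}"

definition b_num :: "'a rel \<Rightarrow> ('a \<Rightarrow> 'a) rel" where
  "b_num \<mu> = (if regularCard \<mu> then b_regular \<mu> else b_singular \<mu>)"

end

theory Submission
  imports Defs
begin

text \<open>
  Let \<open>\<kappa> = cf \<mu>\<close> and let \<open>\<A>\<close> be a nontrivial almost disjoint family smaller than both bounding
  numbers; it is shown not to be maximal. Being smaller than the supremum \<open>b_num \<mu>\<close>, it is
  smaller than the bounding number of \<open>\<Prod>\<^sub>i m i\<close> for one particular sequence \<open>m\<close> of regular cardinals.
  Disjointify \<open>\<kappa>\<close> many members \<open>a i\<close> of \<open>\<A>\<close> into sets \<open>B i\<close>, still of size \<open>\<mu>\<close>. Every
  other member \<open>A\<close> meets each \<open>B i\<close> in fewer than \<open>\<mu>\<close> points, and since \<open>\<A>\<close> is smaller than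
  \<open>b_num \<kappa>\<close> there is a single \<open>h\<close> such that \<open>A \<inter> B i\<close> has size less than \<open>m (h i)\<close> for every
  such \<open>A\<close> and almost all \<open>i\<close>. Copy \<open>m (h i)\<close> into \<open>B i\<close>: by regularity \<open>A\<close> is bounded in almost
  every copy, and a bound \<open>G\<close> for these bounding functions in the product works for all \<open>A\<close>. The
  part \<open>C\<close> of the copies above \<open>G\<close> has size \<open>\<mu>\<close> and meets every member of \<open>\<A>\<close> in fewer than \<open>\<mu>\<close>
  points.
\<close>

section \<open>Minima and suprema of sets of cardinals\<close>

text \<open>Well-orders are well-founded under \<open>\<le>o\<close>, so a nonempty \<open>R\<close>
  has a least element and the choice in \<open>card_Min\<close> is meaningful.\<close>

lemma card_Min_props:
  assumes "R \<noteq> {}" and "\<forall>r\<in>R. Well_order r"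
  shows card_Min_in: "card_Min R \<in> R" and card_Min_le: "r' \<in> R \<Longrightarrow> card_Min R \<le>o r'"
proof -
  have "\<exists>r. r \<in> R \<and> (\<forall>r'\<in>R. r \<le>o r')"
    using exists_minim_Well_order[of R] assms by blast
  then have *: "card_Min R \<in> R \<and> (\<forall>r'\<in>R. card_Min R \<le>o r')"
    unfolding card_Min_def by (rule someI_ex)
  show "card_Min R \<in> R" "r' \<in> R \<Longrightarrow> card_Min R \<le>o r'"
    using * by blast+
qed

lemma Card_order_Well_order: "Card_order r \<Longrightarrow> Well_order r"
  by (simp add: card_order_on_def)

lemma ordLeq_card_UNIV:
  fixes r :: "'b rel"
  assumes "Card_order r"
  shows "r \<le>o |UNIV :: 'b set|"
  using assms Card_order_iff_ordLeq_card_of[of r] card_of_mono1[of "Field r" UNIV]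
    ordLeq_transitive by blast

lemma card_Sup_bounds_nonempty:
  fixes R :: "'b rel set"
  assumes "\<And>s. s \<in> R \<Longrightarrow> Card_order s"
  shows "{r :: 'b rel. Card_order r \<and> (\<forall>s\<in>R. s \<le>o r)} \<noteq> {}"
proof -
  have "|UNIV :: 'b set| \<in> {r :: 'b rel. Card_order r \<and> (\<forall>s\<in>R. s \<le>o r)}"
    by (intro CollectI conjI ballI card_of_Card_order ordLeq_card_UNIV assms)
  then show ?thesis by blast
qed

lemma card_Sup_props:
  fixes R :: "'b rel set"
  assumes "\<And>s. s \<in> R \<Longrightarrow> Card_order s"
  shows Card_order_card_Sup: "Card_order (card_Sup R)"
    and card_Sup_upper: "s \<in> R \<Longrightarrow> s \<le>o card_Sup R"
    and card_Sup_least: "\<lbrakk>Card_order (r :: 'b rel); \<And>s. s \<in> R \<Longrightarrow> s \<le>o r\<rbrakk> \<Longrightarrow> card_Sup R \<le>o r"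
proof -
  let ?U = "{r :: 'b rel. Card_order r \<and> (\<forall>s\<in>R. s \<le>o r)}"
  have wo: "\<forall>r\<in>?U. Well_order r"
    using Card_order_Well_order by blast
  have ne: "?U \<noteq> {}"
    using card_Sup_bounds_nonempty assms by blast
  have "card_Sup R \<in> ?U"
    unfolding card_Sup_def using card_Min_in[OF ne wo] .
  then show "Card_order (card_Sup R)" "s \<in> R \<Longrightarrow> s \<le>o card_Sup R"
    by blast+
  show "card_Sup R \<le>o r" if "Card_order (r :: 'b rel)" "\<And>s. s \<in> R \<Longrightarrow> s \<le>o r"
    unfolding card_Sup_def by (rule card_Min_le[OF ne wo]) (use that in blast)
qed

text \<open>Otherwise every member of \<open>R\<close> is at most \<open>|A|\<close>. Since
  \<open>A\<close> may live on another type, it is first copied to a set \<open>B\<close> on the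
  type of \<open>R\<close>; then \<open>|B|\<close> is one of the upper bounds over which
  \<open>card_Sup\<close> is minimal.\<close>

lemma less_card_Sup:
  fixes R :: "'b rel set" and A :: "'c set"
  assumes R: "\<And>s. s \<in> R \<Longrightarrow> Card_order s" and A: "|A| <o card_Sup R"
  shows "\<exists>s\<in>R. |A| <o s"
proof (rule ccontr)
  assume neg: "\<not> ?thesis"
  obtain B :: "'b set" where B: "|A| =o |B|"
    using A internalize_card_of_ordLess[of A "card_Sup R"] by auto
  have "s \<le>o |B|" if "s \<in> R" for s
  proof -
    have "\<not> |A| <o s"
      using neg that by blast
    then have "s \<le>o |A|"
      using not_ordLess_iff_ordLeq[OF Card_order_Well_order[OF R[OF that]] card_of_Well_order]
      by blast
    then show ?thesis
      using B by (rule ordLeq_ordIso_trans)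
  qed
  then have "card_Sup R \<le>o |B|"
    using card_Sup_least[OF R] card_of_Card_order by blast
  then have "card_Sup R \<le>o |A|"
    using B ordIso_symmetric ordLeq_ordIso_trans by blast
  with A show False
    using not_ordLess_ordLeq by blast
qed

section \<open>Cofinality\<close>

lemma Cinfinite_limit:
  assumes "Cinfinite r" "a \<in> Field r"
  shows "\<exists>b\<in>Field r. a \<noteq> b \<and> (a, b) \<in> r"
  using assms infinite_Card_order_limit[of r a] by (simp add: cinfinite_def)

lemma Well_order_total:
  assumes "Well_order r" "a \<in> Field r" "b \<in> Field r"
  shows "(a, b) \<in> r \<or> (b, a) \<in> r"
  using assms wo_rel.TOTALS[of r] unfolding wo_rel_def by blast

lemma Well_order_trans:
  assumes "Well_order r" "(a, b) \<in> r" "(b, c) \<in> r"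
  shows "(a, c) \<in> r"
  using assms wo_rel.TRANS[of r] unfolding wo_rel_def trans_def by blast

lemma Well_order_antisym:
  assumes "Well_order r" "(a, b) \<in> r" "(b, a) \<in> r"
  shows "a = b"
  using assms wo_rel.ANTISYM[of r] unfolding wo_rel_def antisym_def by blast

lemma Well_order_refl:
  assumes "Well_order r" "a \<in> Field r"
  shows "(a, a) \<in> r"
  using assms wo_rel.REFL[of r] unfolding wo_rel_def refl_on_def by blast

text \<open>An infinite cardinal has no last element, so its whole field is cofinal and the minimum
  defining \<open>cf\<close> is attained.\<close>

lemma cf_props:
  assumes "Cinfinite \<mu>"
  shows cf_witness: "\<exists>K. K \<subseteq> Field \<mu> \<and> cofinal K \<mu> \<and> cf \<mu> = |K|"
    and cf_least: "\<lbrakk>L \<subseteq> Field \<mu>; cofinal L \<mu>\<rbrakk> \<Longrightarrow> cf \<mu> \<le>o |L|"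
proof -
  let ?R = "{|K| | K. K \<subseteq> Field \<mu> \<and> cofinal K \<mu>}"
  have "cofinal (Field \<mu>) \<mu>"
    unfolding cofinal_def using Cinfinite_limit[OF assms] by blast
  then have ne: "?R \<noteq> {}" by blast
  have wo: "\<forall>r\<in>?R. Well_order r"
    using card_of_Well_order by blast
  show "\<exists>K. K \<subseteq> Field \<mu> \<and> cofinal K \<mu> \<and> cf \<mu> = |K|"
    using card_Min_in[OF ne wo] unfolding cf_def by blast
  show "cf \<mu> \<le>o |L|" if "L \<subseteq> Field \<mu>" "cofinal L \<mu>"
    unfolding cf_def by (rule card_Min_le[OF ne wo]) (use that in blast)
qed

lemma not_cofinal_bounded:
  assumes "Well_order r" "L \<subseteq> Field r" "\<not> cofinal L r"
  shows "\<exists>b\<in>Field r. \<forall>a\<in>L. (a, b) \<in> r"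
proof -
  obtain b where b: "b \<in> Field r" "\<forall>a\<in>L. \<not> (b \<noteq> a \<and> (b, a) \<in> r)"
    using assms(3) unfolding cofinal_def by blast
  have "(a, b) \<in> r" if "a \<in> L" for a
    using that b(2) Well_order_total[OF assms(1) subsetD[OF assms(2) that] b(1)]
      Well_order_refl[OF assms(1) b(1)]
    by auto
  then show ?thesis using b(1) by blast
qed

lemma less_cf_bounded:
  assumes "Cinfinite \<mu>" "L \<subseteq> Field \<mu>" "|L| <o cf \<mu>"
  shows "\<exists>b\<in>Field \<mu>. \<forall>a\<in>L. (a, b) \<in> \<mu>"
proof -
  have "\<not> cofinal L \<mu>"
    using assms cf_least not_ordLess_ordLeq by blast
  then show ?thesis
    using assms not_cofinal_bounded Card_order_Well_order by blast
qed

lemma cf_le: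
  assumes "Cinfinite \<mu>"
  shows "cf \<mu> \<le>o \<mu>"
  using cf_witness[OF assms] assms card_of_mono1[of _ "Field \<mu>"] card_of_Field_ordIso
    ordLeq_ordIso_trans by metis

lemma Well_order_finite_bounded:
  assumes "Well_order r" "Field r \<noteq> {}" "finite L" "L \<subseteq> Field r"
  shows "\<exists>b\<in>Field r. \<forall>a\<in>L. (a, b) \<in> r"
  using assms(3,4)
proof (induction L rule: finite_induct)
  case empty
  then show ?case using assms(2) by blast
next
  case (insert x L)
  then obtain b where b: "b \<in> Field r" "\<forall>a\<in>L. (a, b) \<in> r" by blast
  show ?case
  proof (cases "(x, b) \<in> r")
    case True
    then show ?thesis using b by blast
  next
    case False
    then have "(b, x) \<in> r" "x \<in> Field r"
      using Well_order_total[OF assms(1)] b insert.prems by blast+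
    then show ?thesis
      using b Well_order_trans[OF assms(1)] Well_order_refl[OF assms(1)] by blast
  qed
qed

lemma bounded_not_cofinal:
  assumes "Cinfinite r" "b \<in> Field r" "\<forall>a\<in>L. (a, b) \<in> r"
  shows "\<not> cofinal L r"
proof
  assume "cofinal L r"
  then obtain a where "a \<in> L" "b \<noteq> a" "(b, a) \<in> r"
    using assms(2) unfolding cofinal_def by blast
  then show False
    using assms Well_order_antisym[OF Card_order_Well_order, of r a b] by blast
qed

lemma Cinfinite_Field_nonempty: "Cinfinite r \<Longrightarrow> Field r \<noteq> {}"
  unfolding cinfinite_def by auto

text \<open>A finite subset of the field has an upper bound there, hence is not cofinal.\<close>

lemma Cinfinite_cf:
  assumes "Cinfinite \<mu>"
  shows "Cinfinite (cf \<mu>)"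
proof -
  obtain K where K: "K \<subseteq> Field \<mu>" "cofinal K \<mu>" "cf \<mu> = |K|"
    using cf_witness[OF assms] by blast
  have "infinite K"
    using K Well_order_finite_bounded[of \<mu> K] bounded_not_cofinal[OF assms] assms Card_order_Well_order
      Cinfinite_Field_nonempty[OF assms] by blast
  then show ?thesis
    unfolding K(3) cinfinite_def by (simp add: card_of_card_order_on Field_card_of)
qed

text \<open>The order of \<open>cf \<mu> = |K|\<close> need not agree with that of
  \<open>\<mu>\<close> on \<open>K\<close>, so cofinality is transferred through sizes: each proper
  initial segment of \<open>cf \<mu>\<close> is too small to be cofinal in \<open>\<mu>\<close>, and
  fewer than \<open>cf \<mu>\<close> bounds of such segments have a common bound.\<close>

lemma regularCard_cf:
  assumes mu: "Cinfinite \<mu>"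
  shows "regularCard (cf \<mu>)"
  unfolding regularCard_def
proof (intro allI impI)
  fix L assume L: "L \<subseteq> Field (cf \<mu>) \<and> cofinal L (cf \<mu>)"
  obtain K where K: "K \<subseteq> Field \<mu>" "cofinal K \<mu>" "cf \<mu> = |K|"
    using cf_witness[OF mu] by blast
  have wo: "Well_order \<mu>"
    using mu Card_order_Well_order by blast
  have co: "Card_order (cf \<mu>)" and FK: "Field (cf \<mu>) = K"
    by (simp_all add: K(3) card_of_card_order_on Field_card_of)
  have "|L| \<le>o cf \<mu>"
    using L unfolding K(3) by (simp add: Field_card_of card_of_mono1)
  moreover have "\<not> |L| <o cf \<mu>"
  proof
    assume small: "|L| <o cf \<mu>"
    have "\<exists>b. b \<in> Field \<mu> \<and> (\<forall>a\<in>underS (cf \<mu>) l. (a, b) \<in> \<mu>)" if "l \<in> L" for l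
    proof -
      have "underS (cf \<mu>) l \<subseteq> Field \<mu>"
        using FK K(1) unfolding underS_def Field_def by blast
      moreover have "|underS (cf \<mu>) l| <o cf \<mu>"
        using card_of_underS[OF co] L that by blast
      ultimately show ?thesis
        using less_cf_bounded[OF mu] by blast
    qed
    then obtain b where b: "\<And>l. l \<in> L \<Longrightarrow> b l \<in> Field \<mu>"
      "\<And>l a. l \<in> L \<Longrightarrow> a \<in> underS (cf \<mu>) l \<Longrightarrow> (a, b l) \<in> \<mu>"
      by metis
    have "|b ` L| <o cf \<mu>"
      using small card_of_image ordLeq_ordLess_trans by blast
    then obtain c where c: "c \<in> Field \<mu>" "\<forall>a\<in>b ` L. (a, c) \<in> \<mu>"
      using less_cf_bounded[OF mu, of "b ` L"] b(1) by blast
    \<comment> \<open>The segments below the points of \<open>L\<close> cover \<open>K\<close>, so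
      \<open>c\<close> would bound the cofinal set \<open>K\<close>.\<close>
    have "(a, c) \<in> \<mu>" if "a \<in> K" for a
    proof -
      have "\<exists>l\<in>L. a \<noteq> l \<and> (a, l) \<in> cf \<mu>"
        using L that unfolding cofinal_def FK by simp
      then obtain l where l: "l \<in> L" "a \<in> underS (cf \<mu>) l"
        unfolding underS_def by auto
      have "(b l, c) \<in> \<mu>"
        using c(2) l(1) by simp
      then show ?thesis
        by (rule Well_order_trans[OF wo b(2)[OF l]])
    qed
    then show False
      using bounded_not_cofinal[OF mu c(1)] K(2) by blast
  qed
  ultimately show "|L| =o cf \<mu>"
    using ordLeq_iff_ordLess_or_ordIso[of "|L|" "cf \<mu>"] by blast
qed

text \<open>Trades a size below \<open>\<mu>\<close> for a point of \<open>\<mu>\<close>, so that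
  families of sizes can be bounded by cofinality.\<close>

lemma less_le_underS:
  assumes mu: "Card_order \<mu>" and S: "|S| <o \<mu>"
  shows "\<exists>a\<in>Field \<mu>. |S| \<le>o |underS \<mu> a|"
proof -
  obtain a where a: "a \<in> Field \<mu>" "|S| =o Restr \<mu> (underS \<mu> a)"
    using ordLess_iff_ordIso_Restr[of \<mu> "|S|"] S mu Card_order_Well_order card_of_Well_order
    by blast
  let ?p = "Restr \<mu> (underS \<mu> a)"
  have "Card_order ?p"
    using a(2) card_of_Card_order Card_order_ordIso2 by blast
  then have "|S| \<le>o |Field ?p|"
    using a(2) Card_order_iff_ordLeq_card_of ordIso_ordLeq_trans by blast
  also have "|Field ?p| \<le>o |underS \<mu> a|"
    by (intro card_of_mono1) (auto simp: Field_def)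
  finally show ?thesis using a(1) by blast
qed

lemma finite_ordLess_Cinfinite: "finite S \<Longrightarrow> Cinfinite r \<Longrightarrow> |S| <o r"
  using Cfinite_ordLess_Cinfinite[of "|S|" r]
  by (simp add: cfinite_def card_of_card_order_on Field_card_of)

text \<open>The sizes of fewer than \<open>cf \<mu>\<close> sets are bounded by one common initial
  segment of \<open>\<mu>\<close>, so the union is no larger than a product of two cardinals below
  \<open>\<mu>\<close>.\<close>

lemma card_of_UNION_less_cf:
  assumes mu: "Cinfinite \<mu>" and I: "|I| <o cf \<mu>" and S: "\<And>i. i \<in> I \<Longrightarrow> |S i| <o \<mu>"
  shows "|\<Union>i\<in>I. S i| <o \<mu>"
proof -
  have wo: "Well_order \<mu>" and co: "Card_order \<mu>"
    using mu Card_order_Well_order by blast+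
  obtain a where a: "\<And>i. i \<in> I \<Longrightarrow> a i \<in> Field \<mu>" "\<And>i. i \<in> I \<Longrightarrow> |S i| \<le>o |underS \<mu> (a i)|"
    using less_le_underS[OF co S] by metis
  have "|a ` I| <o cf \<mu>"
    using I card_of_image ordLeq_ordLess_trans by blast
  then obtain b where b: "b \<in> Field \<mu>" "\<And>i. i \<in> I \<Longrightarrow> (a i, b) \<in> \<mu>"
    using less_cf_bounded[OF mu, of "a ` I"] a(1) by blast
  have Sb: "|S i| \<le>o |underS \<mu> b|" if "i \<in> I" for i
  proof -
    have "underS \<mu> (a i) \<subseteq> underS \<mu> b"
      using b(2)[OF that] Well_order_trans[OF wo] Well_order_antisym[OF wo]
      unfolding underS_def by blast
    then show ?thesis
      using a(2)[OF that] card_of_mono1 ordLeq_transitive by blast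
  qed
  \<comment> \<open>A single set below \<open>\<mu>\<close> that dominates both the index set and
    every \<open>S i\<close>; if infinite, it dominates their union too.\<close>
  let ?W = "I <+> underS \<mu> b"
  have W: "|?W| <o \<mu>"
    using mu I cf_le[OF mu] card_of_underS[OF co b(1)] ordLess_ordLeq_trans
      card_of_Plus_ordLess_infinite_Field[of \<mu> I] unfolding cinfinite_def by blast
  show ?thesis
  proof (cases "finite ?W")
    case True
    then have "finite (\<Union>i\<in>I. S i)"
      using Sb card_of_ordLeq_finite by (auto simp: finite_Plus_iff)
    then show ?thesis
      using mu finite_ordLess_Cinfinite by blast
  next
    case False
    have "|\<Union>i\<in>I. S i| \<le>o |?W|"
      using Sb card_of_Plus1 card_of_Plus2 ordLeq_transitive
      by (intro card_of_UNION_ordLeq_infinite[OF False]) blast+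
    then show ?thesis using W ordLeq_ordLess_trans by blast
  qed
qed

section \<open>Unbounding numbers\<close>

text \<open>Absence of a maximum makes \<open>P\<close> itself unbounded, so the minimum ranges over
  a nonempty set. The bound is stated for an indexed family because the functions to be bounded
  later are indexed by members of an almost disjoint family.\<close>

lemma unbounding_number_props:
  fixes P :: "'p set"
  assumes "\<not> (\<exists>g\<in>P. \<forall>f\<in>P. le f g)"
  shows Card_order_unbounding_number: "Card_order (unbounding_number P le)"
    and less_unbounding_number_bounded:
      "\<lbrakk>|A| <o unbounding_number P le; F ` A \<subseteq> P\<rbrakk> \<Longrightarrow> \<exists>g\<in>P. \<forall>a\<in>A. le (F a) g"
proof -
  let ?R = "{|B| | B. B \<subseteq> P \<and> \<not> (\<exists>g\<in>P. \<forall>f\<in>B. le f g)}"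
  have ne: "?R \<noteq> {}" using assms by blast
  have wo: "\<forall>r\<in>?R. Well_order r"
    using card_of_Well_order by blast
  show "Card_order (unbounding_number P le)"
    using card_Min_in[OF ne wo] card_of_Card_order by (auto simp: unbounding_number_def)
  show "\<exists>g\<in>P. \<forall>a\<in>A. le (F a) g" if A: "|A| <o unbounding_number P le" "F ` A \<subseteq> P"
  proof (rule ccontr)
    assume "\<not> ?thesis"
    then have "|F ` A| \<in> ?R" using A(2) by (intro CollectI exI[of _ "F ` A"]) auto
    then have "unbounding_number P le \<le>o |F ` A|"
      unfolding unbounding_number_def by (rule card_Min_le[OF ne wo])
    then have "unbounding_number P le \<le>o |A|"
      using card_of_image ordLeq_transitive by blast
    then show False using A(1) not_ordLess_ordLeq by blast
  qed
qed

text \<open>Raising \<open>g\<close> strictly at every coordinate gives a function that exceeds it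
  on all of \<open>\<kappa>\<close>.\<close>

lemma le_star_no_max:
  assumes k: "Cinfinite \<kappa>"
  shows "\<not> (\<exists>g\<in>Field \<kappa> \<rightarrow>\<^sub>E Field \<kappa>. \<forall>f\<in>Field \<kappa> \<rightarrow>\<^sub>E Field \<kappa>. le_star \<kappa> f g)"
proof
  assume "\<exists>g\<in>Field \<kappa> \<rightarrow>\<^sub>E Field \<kappa>. \<forall>f\<in>Field \<kappa> \<rightarrow>\<^sub>E Field \<kappa>. le_star \<kappa> f g"
  then obtain g where g: "g \<in> Field \<kappa> \<rightarrow>\<^sub>E Field \<kappa>"
    and max: "\<And>f. f \<in> Field \<kappa> \<rightarrow>\<^sub>E Field \<kappa> \<Longrightarrow> le_star \<kappa> f g" by blast
  obtain s where s: "\<And>a. a \<in> Field \<kappa> \<Longrightarrow> s a \<in> Field \<kappa> \<and> a \<noteq> s a \<and> (a, s a) \<in> \<kappa>"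
    using Cinfinite_limit[OF k] by metis
  let ?f = "\<lambda>i\<in>Field \<kappa>. s (g i)"
  have gi: "g i \<in> Field \<kappa>" if "i \<in> Field \<kappa>" for i using g that by auto
  have "le_star \<kappa> ?f g"
    using gi s by (intro max) auto
  moreover have "{i \<in> Field \<kappa>. (g i, ?f i) \<in> \<kappa> \<and> ?f i \<noteq> g i} = Field \<kappa>"
    using s[OF gi] by auto (metis)
  ultimately have "|Field \<kappa>| <o \<kappa>"
    unfolding le_star_def by simp
  then show False
    using k card_of_Field_ordIso not_ordLess_ordIso by blast
qed

text \<open>A function strictly above \<open>g\<close> everywhere would make some \<open>j\<close>
  an upper bound of all of \<open>\<kappa>\<close>, which has no last element.\<close>

lemma le_star_prod_no_max:
  assumes k: "Cinfinite \<kappa>" and m: "\<And>i. i \<in> Field \<kappa> \<Longrightarrow> Cinfinite (m i)"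
  defines "P \<equiv> \<Pi>\<^sub>E i\<in>Field \<kappa>. Field (m i)"
  shows "\<not> (\<exists>g\<in>P. \<forall>f\<in>P. le_star_prod \<kappa> m f g)"
proof
  assume "\<exists>g\<in>P. \<forall>f\<in>P. le_star_prod \<kappa> m f g"
  then obtain g where g: "g \<in> P" and max: "\<And>f. f \<in> P \<Longrightarrow> le_star_prod \<kappa> m f g" by blast
  have gi: "g i \<in> Field (m i)" if "i \<in> Field \<kappa>" for i using g that unfolding P_def by auto
  have "\<exists>b\<in>Field (m i). g i \<noteq> b \<and> (g i, b) \<in> m i" if "i \<in> Field \<kappa>" for i
    using Cinfinite_limit[OF m[OF that] gi[OF that]] .
  then obtain f where f: "\<And>i. i \<in> Field \<kappa> \<Longrightarrow> f i \<in> Field (m i) \<and> g i \<noteq> f i \<and> (g i, f i) \<in> m i"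
    by metis
  have "restrict f (Field \<kappa>) \<in> P"
    using f unfolding P_def by auto
  then obtain j where j: "j \<in> Field \<kappa>"
    "\<forall>i\<in>Field \<kappa>. (restrict f (Field \<kappa>) i, g i) \<notin> m i \<longrightarrow> (i, j) \<in> \<kappa>"
    using max unfolding le_star_prod_def by blast
  have "(i, j) \<in> \<kappa>" if "i \<in> Field \<kappa>" for i
    using j(2) that f[OF that] m[OF that] Well_order_antisym[OF Card_order_Well_order, of "m i" "f i" "g i"]
    by auto
  then show False
    using Cinfinite_limit[OF k j(1)] Well_order_antisym[OF Card_order_Well_order, of \<kappa>] k by blast
qed


section \<open>Sequences of regular cardinals\<close>

lemma regular_bounded:
  assumes "Cinfinite r" "regularCard r" "L \<subseteq> Field r" "|L| <o r"
  shows "\<exists>b\<in>Field r. \<forall>a\<in>L. (a, b) \<in> r"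
proof (rule not_cofinal_bounded)
  show "Well_order r"
    using assms(1) Card_order_Well_order by blast
  show "\<not> cofinal L r"
    using assms(2-4) not_ordLess_ordIso unfolding regularCard_def by blast
qed fact

lemma card_of_under:
  assumes r: "Cinfinite r" and a: "a \<in> Field r"
  shows "|under r a| <o r"
proof -
  have "under r a \<subseteq> {a} \<union> underS r a"
    unfolding under_def underS_def by blast
  then have "|under r a| \<le>o |{a} \<union> underS r a|"
    by (rule card_of_mono1)
  also have "|{a} \<union> underS r a| <o r"
    using finite_ordLess_Cinfinite[of "{a}" r] card_of_underS[of r a] r a
    by (intro Un_Cinfinite_bound_strict) auto
  finally show ?thesis .
qed

lemma regular_sequence_Cinfinite:
  assumes "regular_sequence \<mu> \<kappa> m" "i \<in> Field \<kappa>"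
  shows "Cinfinite (m i)" "regularCard (m i)"
  using assms unfolding regular_sequence_def regular_cardinal_def by auto

lemma regular_sequence_mono:
  assumes m: "regular_sequence \<mu> \<kappa> m" and ij: "(i, j) \<in> \<kappa>"
  shows "m i \<le>o m j"
proof (cases "i = j")
  case True
  have "Card_order (m i)"
    using regular_sequence_Cinfinite(1)[OF m, of i] ij by (auto simp: Field_def)
  then show ?thesis
    using True by (simp add: ordLeq_refl)
next
  case False
  then show ?thesis
    using m ij ordLess_imp_ordLeq unfolding regular_sequence_def by blast
qed

lemma regular_sequence_succ:
  assumes m: "regular_sequence \<mu> \<kappa> m" and k: "Cinfinite \<kappa>" and i: "i \<in> Field \<kappa>"
  shows "\<exists>j\<in>Field \<kappa>. m i <o m j"
  using Cinfinite_limit[OF k i] m unfolding regular_sequence_def by blast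

text \<open>Strictness comes from a later, larger term, which is still at most the supremum.\<close>

lemma regular_sequence_less:
  assumes m: "regular_sequence \<mu> \<kappa> m" and k: "Cinfinite \<kappa>" and i: "i \<in> Field \<kappa>"
  shows "m i <o \<mu>"
proof -
  obtain j where j: "j \<in> Field \<kappa>" "m i <o m j"
    using regular_sequence_succ[OF assms] by blast
  note j(2)
  also have "m j \<le>o card_Sup (m ` Field \<kappa>)"
    by (rule card_Sup_upper) (use m j(1) in \<open>auto simp: regular_sequence_Cinfinite\<close>)
  also have "card_Sup (m ` Field \<kappa>) =o \<mu>"
    using m unfolding regular_sequence_def by blast
  finally show ?thesis .
qed

lemma regular_sequence_cofinal:
  assumes m: "regular_sequence \<mu> \<kappa> m" and k: "Cinfinite \<kappa>" and S: "|S| <o \<mu>"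
  shows "\<exists>j\<in>Field \<kappa>. |S| <o m j"
proof -
  have "card_Sup (m ` Field \<kappa>) =o \<mu>"
    using m unfolding regular_sequence_def by blast
  then have "|S| <o card_Sup (m ` Field \<kappa>)"
    using S ordIso_symmetric ordLess_ordIso_trans by blast
  then have "\<exists>s\<in>m ` Field \<kappa>. |S| <o s"
    by (rule less_card_Sup[rotated]) (use m in \<open>auto simp: regular_sequence_Cinfinite\<close>)
  then show ?thesis by blast
qed

section \<open>Almost disjoint families\<close>

text \<open>The pieces are the images of the rows of the square under a bijection of
  \<open>Field r \<times> Field r\<close> with \<open>Field r\<close>.\<close>

lemma Cinfinite_partition:
  assumes r: "Cinfinite r"
  obtains Q where "\<And>x. x \<in> Field r \<Longrightarrow> |Q x| =o r"
    and "(\<Union>x\<in>Field r. Q x) = Field r"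
    and "\<And>x y. x \<in> Field r \<Longrightarrow> y \<in> Field r \<Longrightarrow> x \<noteq> y \<Longrightarrow> Q x \<inter> Q y = {}"
proof -
  let ?F = "Field r"
  have "|?F \<times> ?F| =o |?F|"
    using r by (intro card_of_Times_same_infinite) (simp add: cinfinite_def)
  then obtain p where p: "bij_betw p (?F \<times> ?F) ?F"
    using card_of_ordIso by blast
  define Q where "Q x = p ` ({x} \<times> ?F)" for x
  show thesis
  proof
    fix x assume x: "x \<in> ?F"
    have "inj_on (\<lambda>y. p (x, y)) ?F"
      using p x unfolding bij_betw_def inj_on_def by blast
    then have "bij_betw (\<lambda>y. p (x, y)) ?F (Q x)"
      unfolding bij_betw_def Q_def by auto
    then have "|?F| =o |Q x|"
      by (rule card_of_ordIsoI)
    then show "|Q x| =o r"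
      using r card_of_Field_ordIso ordIso_symmetric ordIso_transitive by blast
  next
    show "(\<Union>x\<in>?F. Q x) = ?F"
      using p unfolding bij_betw_def Q_def by blast
  next
    fix x y assume "x \<in> ?F" "y \<in> ?F" "x \<noteq> y"
    then show "Q x \<inter> Q y = {}"
      using p unfolding bij_betw_def inj_on_def Q_def by blast
  qed
qed

text \<open>
  Injectivity lets a function indexed by \<open>i\<close> be viewed as a partial element of the product at
  coordinates \<open>h i\<close>, so no passage to a subsequence is needed.
\<close>

lemma injective_dominating:
  assumes k: "Cinfinite \<kappa>" and g: "\<And>i. i \<in> Field \<kappa> \<Longrightarrow> g i \<in> Field \<kappa>"
  obtains h where "inj_on h (Field \<kappa>)"
    and "\<And>i. i \<in> Field \<kappa> \<Longrightarrow> h i \<in> Field \<kappa> \<and> (g i, h i) \<in> \<kappa> \<and> (i, h i) \<in> \<kappa>"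
proof -
  have wo: "Well_order \<kappa>"
    using k Card_order_Well_order by blast
  obtain Q where Q: "\<And>x. x \<in> Field \<kappa> \<Longrightarrow> |Q x| =o \<kappa>" "(\<Union>x\<in>Field \<kappa>. Q x) = Field \<kappa>"
    "\<And>x y. x \<in> Field \<kappa> \<Longrightarrow> y \<in> Field \<kappa> \<Longrightarrow> x \<noteq> y \<Longrightarrow> Q x \<inter> Q y = {}"
    using Cinfinite_partition[OF k] by metis
  \<comment> \<open>Choosing \<open>h i\<close> inside the piece \<open>Q i\<close> secures
    injectivity; a piece of size \<open>\<kappa>\<close> cannot lie inside two proper initial
    segments.\<close>
  have "\<exists>x. x \<in> Q i \<and> x \<in> Field \<kappa> \<and> (g i, x) \<in> \<kappa> \<and> (i, x) \<in> \<kappa>" if i: "i \<in> Field \<kappa>" for i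
  proof -
    have "|under \<kappa> (g i) \<union> under \<kappa> i| <o \<kappa>"
      using card_of_under[OF k] g i k by (intro Un_Cinfinite_bound_strict) auto
    then have "\<not> Q i \<subseteq> under \<kappa> (g i) \<union> under \<kappa> i"
      using card_of_mono1 Q(1)[OF i] ordLeq_ordLess_trans not_ordLess_ordIso by blast
    then obtain x where x: "x \<in> Q i" "(x, g i) \<notin> \<kappa>" "(x, i) \<notin> \<kappa>"
      unfolding under_def by blast
    then have "x \<in> Field \<kappa>" using Q(2) i by blast
    then show ?thesis
      using x Well_order_total[OF wo _ g[OF i], of x] Well_order_total[OF wo _ i, of x] by blast
  qed
  then obtain h where h: "\<And>i. i \<in> Field \<kappa> \<Longrightarrow>
      h i \<in> Q i \<and> h i \<in> Field \<kappa> \<and> (g i, h i) \<in> \<kappa> \<and> (i, h i) \<in> \<kappa>"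
    by metis
  show thesis
  proof
    show "inj_on h (Field \<kappa>)"
      using h Q(3) unfolding inj_on_def by (metis disjoint_iff)
  qed (use h in blast)
qed

text \<open>Ensures that \<open>a_num\<close> is really attained by a family. Zorn's lemma extends a
  partition of \<open>Field \<mu>\<close> into \<open>\<mu>\<close> pieces of size
  \<open>\<mu>\<close>; containing all these pieces makes the maximal family nontrivial.\<close>

lemma MAD_nonempty:
  fixes \<mu> :: "'a rel"
  assumes mu: "Cinfinite \<mu>"
  shows "MAD \<mu> \<noteq> {}"
proof -
  let ?F = "Field \<mu>"
  have F: "|?F| =o \<mu>"
    using mu card_of_Field_ordIso by blast
  obtain Q where Q: "\<And>x. x \<in> ?F \<Longrightarrow> |Q x| =o \<mu>" "(\<Union>x\<in>?F. Q x) = ?F"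
    "\<And>x y. x \<in> ?F \<Longrightarrow> y \<in> ?F \<Longrightarrow> x \<noteq> y \<Longrightarrow> Q x \<inter> Q y = {}"
    using Cinfinite_partition[OF mu] by metis
  \<comment> \<open>The union is fixed to be \<open>Field \<mu>\<close>, so adding a subset of it
    stays in \<open>X\<close> and maximality in \<open>X\<close> gives \<open>mad\<close>.\<close>
  define X where "X = {\<A>. almost_disjoint \<mu> \<A> \<and> \<Union>\<A> = ?F \<and> Q ` ?F \<subseteq> \<A>}"
  have "almost_disjoint \<mu> (Q ` ?F)"
    unfolding almost_disjoint_def
  proof (intro conjI ballI impI)
    fix A B assume "A \<in> Q ` ?F" "B \<in> Q ` ?F" "A \<noteq> B"
    then have "A \<inter> B = {}" using Q(3) by blast
    then show "|A \<inter> B| <o \<mu>"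
      using finite_ordLess_Cinfinite[of "A \<inter> B"] mu by simp
  qed (use Q F in auto)
  then have "Q ` ?F \<in> X"
    using Q(2) unfolding X_def by blast
  moreover have "\<Union>\<C> \<in> X" if ne: "\<C> \<noteq> {}" and ch: "subset.chain X \<C>" for \<C>
  proof -
    have CX: "\<C> \<subseteq> X" and lin: "\<And>\<A> \<B>. \<A> \<in> \<C> \<Longrightarrow> \<B> \<in> \<C> \<Longrightarrow> \<A> \<subseteq> \<B> \<or> \<B> \<subseteq> \<A>"
      using ch by (auto simp: subset_chain_def)
    have U: "\<Union>(\<Union>\<C>) = ?F"
      using CX ne unfolding X_def by blast
    have "almost_disjoint \<mu> (\<Union>\<C>)"
      unfolding almost_disjoint_def U
    proof (intro conjI ballI impI F)
      fix A assume "A \<in> \<Union>\<C>"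
      then show "|A| =o \<mu>"
        using CX unfolding X_def almost_disjoint_def by blast
    next
      fix A B assume AB: "A \<in> \<Union>\<C>" "B \<in> \<Union>\<C>" "A \<noteq> B"
      then obtain \<A> where "\<A> \<in> \<C>" "A \<in> \<A>" "B \<in> \<A>"
        using lin by blast
      then show "|A \<inter> B| <o \<mu>"
        using CX AB(3) unfolding X_def almost_disjoint_def by blast
    qed
    moreover have "Q ` ?F \<subseteq> \<Union>\<C>"
      using CX ne unfolding X_def by blast
    ultimately show ?thesis
      using U unfolding X_def by blast
  qed
  ultimately obtain \<A> where A: "\<A> \<in> X" "\<And>\<B>. \<B> \<in> X \<Longrightarrow> \<A> \<subseteq> \<B> \<Longrightarrow> \<B> = \<A>"
    using subset_Zorn_nonempty[of X] by blast
  have "mad \<mu> \<A>"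
    unfolding mad_def
  proof (intro conjI notI)
    show "almost_disjoint \<mu> \<A>"
      using A(1) unfolding X_def by blast
    assume "\<exists>C. C \<subseteq> \<Union>\<A> \<and> C \<notin> \<A> \<and> almost_disjoint \<mu> (insert C \<A>)"
    then obtain C where C: "C \<subseteq> \<Union>\<A>" "C \<notin> \<A>" "almost_disjoint \<mu> (insert C \<A>)"
      by blast
    then have "insert C \<A> \<in> X"
      using A(1) unfolding X_def by blast
    then show False
      using A(2)[of "insert C \<A>"] C(2) by blast
  qed
  moreover have "\<not> trivial_family \<mu> \<A>"
  proof -
    have "inj_on Q ?F"
    proof (rule inj_onI, rule ccontr)
      fix x y assume xy: "x \<in> ?F" "y \<in> ?F" "Q x = Q y" "x \<noteq> y"
      then have "Q x = {}" using Q(3)[of x y] by blast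
      then have "|{} :: 'a set| =o \<mu>" using Q(1)[OF xy(1)] by simp
      then show False
        using finite_ordLess_Cinfinite[of "{} :: 'a set" \<mu>] mu not_ordLess_ordIso by blast
    qed
    moreover have "Q ` ?F \<subseteq> \<A>"
      using A(1) unfolding X_def by blast
    ultimately have "|?F| \<le>o |\<A>|"
      using card_of_ordLeq by blast
    then have "cf \<mu> \<le>o |\<A>|"
      using cf_le[OF mu] F ordIso_symmetric ordLeq_ordIso_trans ordLeq_transitive by blast
    then show ?thesis
      unfolding trivial_family_def using not_ordLess_ordLeq by blast
  qed
  ultimately show ?thesis
    unfolding MAD_def by blast
qed


section \<open>Diagonalising against a small almost disjoint family\<close>

lemma exists_almost_disjoint_set:
  fixes \<mu> :: "'a rel" and \<A> :: "'a set set"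
  assumes mu: "Cinfinite \<mu>" and m: "regular_sequence \<mu> (cf \<mu>) m"
    and ad: "almost_disjoint \<mu> \<A>" and nontriv: "cf \<mu> \<le>o |\<A>|"
    and b1: "|\<A>| <o b_regular (cf \<mu>)"
    and b2: "|\<A>| <o unbounding_number (\<Pi>\<^sub>E i\<in>Field (cf \<mu>). Field (m i)) (le_star_prod (cf \<mu>) m)"
  shows "\<exists>C\<subseteq>\<Union>\<A>. |C| =o \<mu> \<and> (\<forall>A\<in>\<A>. |C \<inter> A| <o \<mu>)"
proof -
  define \<kappa> where "\<kappa> = cf \<mu>"
  define I where "I = Field \<kappa>"
  have k: "Cinfinite \<kappa>" and reg: "regularCard \<kappa>"
    unfolding \<kappa>_def using Cinfinite_cf[OF mu] regularCard_cf[OF mu] by blast+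
  have wo: "Well_order \<kappa>"
    using k Card_order_Well_order by blast
  note m = m[folded \<kappa>_def]
  have mi: "Cinfinite (m i)" "regularCard (m i)" "Well_order (m i)" if "i \<in> I" for i
    using regular_sequence_Cinfinite[OF m] Card_order_Well_order that unfolding I_def by blast+
  \<comment> \<open>Initial segments of \<open>\<kappa> = cf \<mu>\<close> have fewer than
    \<open>cf \<mu>\<close> elements.\<close>
  have union_small: "|\<Union>i\<in>under \<kappa> j. S i| <o \<mu>"
    if "j \<in> I" "\<And>i. i \<in> under \<kappa> j \<Longrightarrow> |S i| <o \<mu>" for S :: "'a \<Rightarrow> 'a set" and j
    using card_of_UNION_less_cf[OF mu, of "under \<kappa> j" S] card_of_under[OF k] that
    unfolding \<kappa>_def I_def by blast
  have "|I| \<le>o |\<A>|"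
    using card_of_Field_ordIso[of \<kappa>] k nontriv ordIso_ordLeq_trans unfolding I_def \<kappa>_def by blast
  then obtain a where a: "inj_on a I" "a ` I \<subseteq> \<A>"
    using card_of_ordLeq[of I \<A>] by auto
  have A_card: "|A| =o \<mu>" if "A \<in> \<A>" for A
    using ad that unfolding almost_disjoint_def by blast
  have A_inter: "|A \<inter> A'| <o \<mu>" if "A \<in> \<A>" "A' \<in> \<A>" "A \<noteq> A'" for A A'
    using ad that unfolding almost_disjoint_def by blast
  define B where "B i = a i - \<Union>(a ` underS \<kappa> i)" for i
  have B_large: "\<not> |B i| <o \<mu>" if i: "i \<in> I" for i
  proof
    assume small: "|B i| <o \<mu>"
    \<comment> \<open>Index \<open>i\<close> carries the remainder \<open>B i\<close> and each
      earlier \<open>j\<close> the overlap with \<open>a j\<close>; together they cover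
      \<open>a i\<close>, which would then be too small.\<close>
    define S where "S j = (if j = i then B i else a i \<inter> a j)" for j
    have "|S j| <o \<mu>" if j: "j \<in> under \<kappa> i" for j
    proof (cases "j = i")
      case False
      have "j \<in> I" using j unfolding under_def I_def Field_def by blast
      then have "a i \<noteq> a j" using a(1) False i unfolding inj_on_def by blast
      then show ?thesis using False A_inter a(2) i \<open>j \<in> I\<close> unfolding S_def by auto
    qed (simp add: S_def small)
    then have "|\<Union>j\<in>under \<kappa> i. S j| <o \<mu>"
      by (rule union_small[OF i])
    moreover have "a i \<subseteq> (\<Union>j\<in>under \<kappa> i. S j)"
    proof
      fix x assume x: "x \<in> a i"
      show "x \<in> (\<Union>j\<in>under \<kappa> i. S j)"
      proof (cases "x \<in> B i")
        case True
        then show ?thesis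
          using Well_order_refl[OF wo, of i] i unfolding S_def under_def I_def by auto
      next
        case False
        then obtain j where "j \<in> underS \<kappa> i" "x \<in> a j"
          using x unfolding B_def by blast
        then show ?thesis
          using x unfolding S_def under_def underS_def by auto
      qed
    qed
    ultimately have "|a i| <o \<mu>"
      using card_of_mono1 ordLeq_ordLess_trans by blast
    then show False
      using A_card[of "a i"] a(2) i not_ordLess_ordIso by blast
  qed

  \<comment> \<open>Only these members need the bounding numbers; the sets \<open>a i\<close> are
    handled by the disjointness built into \<open>B\<close>.\<close>
  define \<A>' where "\<A>' = \<A> - a ` I"
  have A'_le: "|\<A>'| \<le>o |\<A>|"
    unfolding \<A>'_def by (rule card_of_mono1) blast
  have small: "|A \<inter> B i| <o \<mu>" if "A \<in> \<A>'" "i \<in> I" for A i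
  proof -
    have "|A \<inter> a i| <o \<mu>"
      using A_inter[of A "a i"] that a(2) unfolding \<A>'_def by blast
    moreover have "|A \<inter> B i| \<le>o |A \<inter> a i|"
      unfolding B_def by (rule card_of_mono1) blast
    ultimately show ?thesis using ordLeq_ordLess_trans by blast
  qed
  have "\<exists>j\<in>I. |A \<inter> B i| <o m j" if "A \<in> \<A>'" "i \<in> I" for A i
    using regular_sequence_cofinal[OF m k small[OF that]] unfolding I_def .
  \<comment> \<open>Sizes of traces are coded by indices in \<open>\<kappa>\<close>, giving one
    function from \<open>\<kappa>\<close> to \<open>\<kappa>\<close> per member, as
    \<open>b_regular\<close> requires.\<close>
  then obtain f where f: "\<And>A i. A \<in> \<A>' \<Longrightarrow> i \<in> I \<Longrightarrow> f A i \<in> I \<and> |A \<inter> B i| <o m (f A i)"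
    by metis
  have "\<exists>g\<in>I \<rightarrow>\<^sub>E I. \<forall>A\<in>\<A>'. le_star \<kappa> (restrict (f A) I) g"
    using less_unbounding_number_bounded[OF le_star_no_max[OF k], of \<A>' "\<lambda>A. restrict (f A) I"]
      ordLeq_ordLess_trans[OF A'_le b1] f
    unfolding b_regular_def \<kappa>_def[symmetric] I_def[symmetric] by (auto simp: image_subset_iff)
  then obtain g where g: "g \<in> I \<rightarrow>\<^sub>E I" "\<And>A. A \<in> \<A>' \<Longrightarrow> le_star \<kappa> (restrict (f A) I) g"
    by blast
  have gI: "g i \<in> Field \<kappa>" if "i \<in> Field \<kappa>" for i
    using g(1) that unfolding I_def by auto
  obtain h where h: "inj_on h I"
    "\<And>i. i \<in> I \<Longrightarrow> h i \<in> I \<and> (g i, h i) \<in> \<kappa> \<and> (i, h i) \<in> \<kappa>"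
    using injective_dominating[of \<kappa> g] k gI unfolding I_def by blast

  have trace_small: "\<exists>j\<in>I. \<forall>i\<in>I. (i, j) \<notin> \<kappa> \<longrightarrow> |A \<inter> B i| <o m (h i)" if A: "A \<in> \<A>'" for A
  proof -
    define L where "L = {i \<in> I. (g i, f A i) \<in> \<kappa> \<and> f A i \<noteq> g i}"
    have "{i \<in> Field \<kappa>. (g i, restrict (f A) I i) \<in> \<kappa> \<and> restrict (f A) I i \<noteq> g i} = L"
      unfolding L_def I_def by auto
    then have "|L| <o \<kappa>"
      using g(2)[OF A] unfolding le_star_def by simp
    \<comment> \<open>\<open>le_star\<close> only makes the exceptional set small; regularity of
      \<open>\<kappa>\<close> makes it bounded.\<close>
    then obtain j where j: "j \<in> I" "\<forall>i\<in>L. (i, j) \<in> \<kappa>"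
      using regular_bounded[OF k reg, of L] unfolding L_def I_def by auto
    have "|A \<inter> B i| <o m (h i)" if i: "i \<in> I" "(i, j) \<notin> \<kappa>" for i
    proof -
      have "i \<notin> L" using j(2) i(2) by blast
      then have "(f A i, g i) \<in> \<kappa>"
        using i(1) Well_order_total[OF wo, of "f A i" "g i"] Well_order_refl[OF wo, of "g i"]
          f[OF A i(1)] gI[of i] unfolding L_def I_def by auto
      then have "(f A i, h i) \<in> \<kappa>"
        using Well_order_trans[OF wo _ conjunct1[OF conjunct2[OF h(2)[OF i(1)]]]] by blast
      then have "m (f A i) \<le>o m (h i)"
        by (rule regular_sequence_mono[OF m])
      then show ?thesis
        using f[OF A i(1)] ordLess_ordLeq_trans by blast
    qed
    then show ?thesis using j(1) by blast
  qed

  \<comment> \<open>The copy of \<open>m (h i)\<close> fits because \<open>m (h i)\<close> is below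
    \<open>\<mu>\<close> while \<open>B i\<close> has size at least \<open>\<mu>\<close>.\<close>
  have "\<exists>e. inj_on e (Field (m (h i))) \<and> e ` Field (m (h i)) \<subseteq> B i" if i: "i \<in> I" for i
  proof -
    have hi: "h i \<in> I" using h(2)[OF i] by blast
    have "|Field (m (h i))| =o m (h i)"
      using mi(1)[OF hi] card_of_Field_ordIso by blast
    also have "m (h i) <o \<mu>"
      using regular_sequence_less[OF m k] hi unfolding I_def by blast
    also have "\<mu> \<le>o |B i|"
      using B_large[OF i] not_ordLess_iff_ordLeq[of \<mu> "|B i|"] mu Card_order_Well_order
        card_of_Well_order by blast
    finally have "|Field (m (h i))| \<le>o |B i|"
      by (rule ordLess_imp_ordLeq)
    then show ?thesis
      using card_of_ordLeq by blast
  qed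
  then obtain e where e: "\<And>i. i \<in> I \<Longrightarrow> inj_on (e i) (Field (m (h i)))"
    "\<And>i. i \<in> I \<Longrightarrow> e i ` Field (m (h i)) \<subseteq> B i"
    by metis

  define P where "P = (\<Pi>\<^sub>E i\<in>I. Field (m i))"
  have "\<exists>F. F \<in> P \<and> (\<forall>i\<in>I. |A \<inter> B i| <o m (h i) \<longrightarrow>
      (\<forall>x\<in>Field (m (h i)). e i x \<in> A \<longrightarrow> (x, F (h i)) \<in> m (h i)))" for A
  proof -
    have "\<exists>b\<in>Field (m (h i)). |A \<inter> B i| <o m (h i) \<longrightarrow>
        (\<forall>x\<in>Field (m (h i)). e i x \<in> A \<longrightarrow> (x, b) \<in> m (h i))" if i: "i \<in> I" for i
    proof (cases "|A \<inter> B i| <o m (h i)")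
      case True
      have hi: "h i \<in> I" using h(2)[OF i] by blast
      define L where "L = {x \<in> Field (m (h i)). e i x \<in> A}"
      have "inj_on (e i) L" "e i ` L \<subseteq> A \<inter> B i"
        using e[OF i] unfolding L_def inj_on_def by blast+
      then have "|L| \<le>o |A \<inter> B i|"
        using card_of_ordLeq by blast
      then have "|L| <o m (h i)"
        using True ordLeq_ordLess_trans by blast
      then show ?thesis
        using regular_bounded[OF mi(1,2)[OF hi], of L] unfolding L_def by blast
    next
      case False
      then show ?thesis
        using Cinfinite_Field_nonempty[OF mi(1)] h(2)[OF i] by blast
    qed
    then obtain b where b: "\<And>i. i \<in> I \<Longrightarrow> b i \<in> Field (m (h i))"
      "\<And>i x. i \<in> I \<Longrightarrow> |A \<inter> B i| <o m (h i) \<Longrightarrow> x \<in> Field (m (h i)) \<Longrightarrow> e i x \<in> A \<Longrightarrow>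
         (x, b i) \<in> m (h i)"
      by metis
    \<comment> \<open>The bound found in the copy inside \<open>B i\<close> is stored at coordinate
      \<open>h i\<close>; injectivity of \<open>h\<close> prevents clashes, and coordinates outside
      its range get arbitrary values.\<close>
    define F where "F = (\<lambda>j\<in>I. if j \<in> h ` I then b (inv_into I h j) else (SOME x. x \<in> Field (m j)))"
    have Fh: "F (h i) = b i" if "i \<in> I" for i
      using that h unfolding F_def by (simp add: inv_into_f_f)
    have "F j \<in> Field (m j)" if j: "j \<in> I" for j
    proof (cases "j \<in> h ` I")
      case True
      then show ?thesis using Fh b(1) by auto
    next
      case False
      then show ?thesis
        using j some_in_eq[of "Field (m j)"] Cinfinite_Field_nonempty[OF mi(1)[OF j]]
        unfolding F_def by simp
    qed
    then have "F \<in> P"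
      unfolding P_def by (auto simp: F_def)
    then show ?thesis
      using b(2) Fh by (intro exI[of _ F]) auto
  qed
  then obtain F where F: "\<And>A. F A \<in> P"
    "\<And>A i x. i \<in> I \<Longrightarrow> |A \<inter> B i| <o m (h i) \<Longrightarrow> x \<in> Field (m (h i)) \<Longrightarrow> e i x \<in> A \<Longrightarrow>
       (x, F A (h i)) \<in> m (h i)"
    by metis
  have "\<exists>G\<in>P. \<forall>A\<in>\<A>'. le_star_prod \<kappa> m (F A) G"
    using less_unbounding_number_bounded[OF le_star_prod_no_max[OF k, of m], of \<A>' F]
      ordLeq_ordLess_trans[OF A'_le b2] F(1) mi(1)
    unfolding P_def \<kappa>_def[symmetric] I_def[symmetric] by blast
  then obtain G where G: "G \<in> P" "\<And>A. A \<in> \<A>' \<Longrightarrow> le_star_prod \<kappa> m (F A) G"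
    by blast

  define D where "D i = e i ` {x \<in> Field (m (h i)). (x, G (h i)) \<notin> m (h i)}" for i
  define C where "C = (\<Union>i\<in>I. D i)"
  have DB: "D i \<subseteq> B i" if "i \<in> I" for i
    using e(2)[OF that] unfolding D_def by blast
  have D_small: "|D i| <o \<mu>" if i: "i \<in> I" for i
  proof -
    have hi: "h i \<in> I" using h(2)[OF i] by blast
    have "|D i| \<le>o |{x \<in> Field (m (h i)). (x, G (h i)) \<notin> m (h i)}|"
      unfolding D_def by (rule card_of_image)
    also have "|{x \<in> Field (m (h i)). (x, G (h i)) \<notin> m (h i)}| \<le>o |Field (m (h i))|"
      by (rule card_of_mono1) blast
    also have "|Field (m (h i))| =o m (h i)"
      using mi(1)[OF hi] card_of_Field_ordIso by blast
    also have "m (h i) <o \<mu>"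
      using regular_sequence_less[OF m k] hi unfolding I_def by blast
    finally show ?thesis .
  qed
  \<comment> \<open>If \<open>X\<close> misses \<open>D i\<close> for all \<open>i\<close> past
    \<open>j\<close>, then \<open>C \<inter> X\<close> lies in fewer than \<open>cf \<mu>\<close> of
    the small sets \<open>D i\<close>.\<close>
  have C_inter: "|C \<inter> X| <o \<mu>"
    if j: "j \<in> I" "\<And>i. i \<in> I \<Longrightarrow> (i, j) \<notin> \<kappa> \<Longrightarrow> D i \<inter> X = {}" for X j
  proof -
    have "C \<inter> X \<subseteq> (\<Union>i\<in>under \<kappa> j. D i)"
      using j(2) unfolding C_def under_def by blast
    moreover have "|\<Union>i\<in>under \<kappa> j. D i| <o \<mu>"
      using D_small by (intro union_small[OF j(1)]) (auto simp: under_def I_def Field_def)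
    ultimately show ?thesis
      using card_of_mono1 ordLeq_ordLess_trans by blast
  qed
  have C_ad: "|C \<inter> A| <o \<mu>" if A: "A \<in> \<A>" for A
  proof (cases "A \<in> a ` I")
    case True
    then obtain i where i: "i \<in> I" "A = a i" by blast
    \<comment> \<open>For \<open>l\<close> after \<open>i\<close>, the set \<open>B l\<close> was
      formed by removing \<open>a i\<close>.\<close>
    have "D l \<inter> A = {}" if l: "l \<in> I" "(l, i) \<notin> \<kappa>" for l
    proof -
      have "i \<in> underS \<kappa> l"
        using Well_order_total[OF wo, of l i] Well_order_refl[OF wo, of i] l i(1)
        unfolding I_def underS_def by auto
      then show ?thesis
        using DB[OF l(1)] i(2) unfolding B_def by blast
    qed
    then show ?thesis by (rule C_inter[OF i(1)])
  next
    case False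
    then have A': "A \<in> \<A>'" using A unfolding \<A>'_def by blast
    obtain j1 where j1: "j1 \<in> I" "\<And>i. i \<in> I \<Longrightarrow> (i, j1) \<notin> \<kappa> \<Longrightarrow> |A \<inter> B i| <o m (h i)"
      using trace_small[OF A'] by blast
    obtain j2 where j2: "j2 \<in> I" "\<And>i. i \<in> I \<Longrightarrow> (i, j2) \<notin> \<kappa> \<Longrightarrow> (F A i, G i) \<in> m i"
      using G(2)[OF A'] unfolding le_star_prod_def I_def by blast
    \<comment> \<open>Past \<open>j\<close> both the trace bound at \<open>i\<close> and the
      domination at \<open>h i\<close> are available, the latter because \<open>h i\<close> is not
      before \<open>i\<close>.\<close>
    obtain j where j: "j \<in> I" "(j1, j) \<in> \<kappa>" "(j2, j) \<in> \<kappa>"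
      using Well_order_finite_bounded[OF wo, of "{j1, j2}"] j1(1) j2(1) unfolding I_def by auto
    have "D i \<inter> A = {}" if i: "i \<in> I" "(i, j) \<notin> \<kappa>" for i
    proof (rule ccontr)
      assume "D i \<inter> A \<noteq> {}"
      then obtain x where x: "x \<in> Field (m (h i))" "(x, G (h i)) \<notin> m (h i)" "e i x \<in> A"
        unfolding D_def by blast
      have hi: "h i \<in> I" "(i, h i) \<in> \<kappa>" using h(2)[OF i(1)] by blast+
      have "(i, j1) \<notin> \<kappa>"
        using i(2) Well_order_trans[OF wo _ j(2)] by blast
      then have "(x, F A (h i)) \<in> m (h i)"
        using F(2) j1(2) i(1) x by blast
      moreover have "(h i, j2) \<notin> \<kappa>"
        using i(2) Well_order_trans[OF wo hi(2)] Well_order_trans[OF wo _ j(3)] by blast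
      then have "(F A (h i), G (h i)) \<in> m (h i)"
        using j2(2) hi(1) by blast
      ultimately show False
        using x(2) Well_order_trans[OF mi(3)[OF hi(1)]] by blast
    qed
    then show ?thesis by (rule C_inter[OF j(1)])
  qed
  have C_sub: "C \<subseteq> \<Union>\<A>"
    using DB a(2) unfolding C_def B_def by blast
  have "\<not> |C| <o \<mu>"
  proof
    assume "|C| <o \<mu>"
    then obtain j where j: "j \<in> I" "|C| <o m j"
      using regular_sequence_cofinal[OF m k] unfolding I_def by blast
    have hj: "h j \<in> I" "(j, h j) \<in> \<kappa>" using h(2)[OF j(1)] by blast+
    \<comment> \<open>\<open>D j\<close> alone is large enough: \<open>?U\<close> and the elements
      up to \<open>G (h j)\<close> cover \<open>m (h j)\<close>, but under the assumption on
      \<open>C\<close> both would have size below \<open>m (h j)\<close>.\<close>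
    let ?U = "{x \<in> Field (m (h j)). (x, G (h j)) \<notin> m (h j)}"
    have "inj_on (e j) ?U" "e j ` ?U \<subseteq> C"
      using e(1)[OF j(1)] j(1) unfolding C_def D_def inj_on_def by blast+
    then have "|?U| \<le>o |C|"
      using card_of_ordLeq by blast
    also note j(2)
    also have "m j \<le>o m (h j)"
      using regular_sequence_mono[OF m hj(2)] .
    finally have U: "|?U| <o m (h j)" .
    have "G (h j) \<in> Field (m (h j))"
      using G(1) hj(1) unfolding P_def by auto
    then have "|?U \<union> under (m (h j)) (G (h j))| <o m (h j)"
      using U card_of_under[OF mi(1)[OF hj(1)]] mi(1)[OF hj(1)]
      by (intro Un_Cinfinite_bound_strict) auto
    moreover have "Field (m (h j)) \<subseteq> ?U \<union> under (m (h j)) (G (h j))"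
      unfolding under_def by blast
    ultimately have "|Field (m (h j))| <o m (h j)"
      using card_of_mono1 ordLeq_ordLess_trans by blast
    then show False
      using mi(1)[OF hj(1)] card_of_Field_ordIso not_ordLess_ordIso by blast
  qed
  moreover have "|C| \<le>o \<mu>"
  proof -
    have "\<A> \<noteq> {}"
      using a(2) Cinfinite_Field_nonempty[OF k] unfolding I_def by blast
    then have "|\<Union>\<A>| =o \<mu>"
      using ad unfolding almost_disjoint_def by blast
    then show ?thesis
      using card_of_mono1[OF C_sub] ordLeq_ordIso_trans by blast
  qed
  ultimately have "|C| =o \<mu>"
    using ordLeq_iff_ordLess_or_ordIso[of "|C|" \<mu>] by blast
  then show ?thesis
    using C_sub C_ad by blast
qed

theorem theorem2p1:
  fixes \<mu> :: "'a rel"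
  assumes "singular_cardinal \<mu>"
  shows "card_Min {b_num \<mu>, b_num (cf \<mu>)} \<le>o a_num \<mu>"
proof (rule ccontr)
  assume neg: "\<not> ?thesis"
  have mu: "Cinfinite \<mu>" and sing: "\<not> regularCard \<mu>"
    using assms unfolding singular_cardinal_def by blast+
  note k = Cinfinite_cf[OF mu]
  let ?b = "\<lambda>m. unbounding_number (\<Pi>\<^sub>E i\<in>Field (cf \<mu>). Field (m i)) (le_star_prod (cf \<mu>) m)"
  have b_mu: "b_num \<mu> = card_Sup {?b m | m. regular_sequence \<mu> (cf \<mu>) m}"
    using sing unfolding b_num_def b_singular_def by simp
  have b_cf: "b_num (cf \<mu>) = b_regular (cf \<mu>)"
    using regularCard_cf[OF mu] unfolding b_num_def by simp
  have card_b: "Card_order s" if s: "s \<in> {?b m | m. regular_sequence \<mu> (cf \<mu>) m}" for s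
  proof -
    obtain m where m: "s = ?b m" "regular_sequence \<mu> (cf \<mu>) m"
      using s by blast
    show ?thesis
      unfolding m(1)
      by (rule Card_order_unbounding_number[OF le_star_prod_no_max[OF k]])
        (rule regular_sequence_Cinfinite(1)[OF m(2)])
  qed
  have "Card_order (b_num \<mu>)"
    unfolding b_mu using card_b by (rule Card_order_card_Sup)
  moreover have "Card_order (b_num (cf \<mu>))"
    unfolding b_cf b_regular_def
    by (rule Card_order_unbounding_number[OF le_star_no_max[OF k]])
  ultimately have wo: "\<forall>r\<in>{b_num \<mu>, b_num (cf \<mu>)}. Well_order r"
    using Card_order_Well_order by blast
  have "\<forall>r\<in>MAD \<mu>. Well_order r"
    unfolding MAD_def using card_of_Well_order by blast
  then have "a_num \<mu> \<in> MAD \<mu>"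
    unfolding a_num_def using card_Min_in[OF MAD_nonempty[OF mu]] by blast
  then obtain \<A> where A: "a_num \<mu> = |\<A>|" "mad \<mu> \<A>" "\<not> |\<A>| <o cf \<mu>"
    unfolding MAD_def trivial_family_def by blast
  let ?M = "card_Min {b_num \<mu>, b_num (cf \<mu>)}"
  have "Well_order ?M"
    using card_Min_in[OF _ wo] wo by blast
  then have less: "|\<A>| <o ?M"
    using neg not_ordLeq_iff_ordLess[OF card_of_Well_order] unfolding A(1) by blast
  have "?M \<le>o b_num \<mu>" "?M \<le>o b_num (cf \<mu>)"
    using card_Min_le[OF _ wo] by blast+
  then have "|\<A>| <o b_num \<mu>" and b1: "|\<A>| <o b_regular (cf \<mu>)"
    using less ordLess_ordLeq_trans unfolding b_cf by blast+
  \<comment> \<open>Being below the supremum yields a single sequence whose bounding number already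
    exceeds \<open>|\<A>|\<close>.\<close>
  then obtain m where m: "regular_sequence \<mu> (cf \<mu>) m" "|\<A>| <o ?b m"
    using less_card_Sup[OF card_b] unfolding b_mu by blast
  have ad: "almost_disjoint \<mu> \<A>"
    using A(2) unfolding mad_def by blast
  have nontriv: "cf \<mu> \<le>o |\<A>|"
    using A(3) not_ordLess_iff_ordLeq[OF Card_order_Well_order card_of_Well_order] k by blast
  obtain C where C: "C \<subseteq> \<Union>\<A>" "|C| =o \<mu>" "\<And>A. A \<in> \<A> \<Longrightarrow> |C \<inter> A| <o \<mu>"
    using exists_almost_disjoint_set[OF mu m(1) ad nontriv b1 m(2)] by blast
  \<comment> \<open>Otherwise \<open>C\<close> would meet itself in fewer than \<open>\<mu>\<close>
    points.\<close>
  have "C \<notin> \<A>"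
    using C(2) C(3)[of C] not_ordLess_ordIso by auto
  moreover have "almost_disjoint \<mu> (insert C \<A>)"
    unfolding almost_disjoint_def
  proof (intro conjI ballI impI)
    fix A assume "A \<in> insert C \<A>"
    then show "|A| =o \<mu>"
      using ad C(2) unfolding almost_disjoint_def by blast
    have "\<Union>(insert C \<A>) = \<Union>\<A>" using C(1) by blast
    moreover have "\<A> \<noteq> {}"
    proof
      assume "\<A> = {}"
      then have "C = {}" using C(1) by blast
      then show False
        using C(2) finite_ordLess_Cinfinite[OF _ mu, of C] not_ordLess_ordIso by blast
    qed
    ultimately show "|\<Union>(insert C \<A>)| =o \<mu>"
      using ad unfolding almost_disjoint_def by auto
  next
    fix A B assume "A \<in> insert C \<A>" "B \<in> insert C \<A>" "A \<noteq> B"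
    then show "|A \<inter> B| <o \<mu>"
      using ad C(3) unfolding almost_disjoint_def by (auto simp: Int_commute)
  qed
  ultimately show False
    using A(2) C(1) unfolding mad_def by blast
qed

end
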